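(* Let $a,b,N,M\in\mathbb{N}$ with $b\mid a$ and $N\le M$. Then $$[q^n]\,g_{a,b,a+b}(N,M;q)\ge 0\qquad\text{for all integers }0\le n<a+2(a+b).$$ Equivalently, for all $k,N,M\in\mathbb{N}$ with $N\le M$, $$[x^r]\,G_{k,N,M}(x)\ge 0\qquad\text{for all integers }0\le r<3k+2.$$
   Context: $\mathbb{N}$ is the set of positive integers. Notation: $(z;q)_n=\prod_{i=0}^{n-1}(1-zq^i)$; $[q^n]f$ denotes the coefficient of $q^n$ in the formal power series $f$. For $a,b,m,N,M\in\mathbb{N}$, $$g_{a,b,m}(N,M;q):=\frac{(-q^m;q^m)_{N+M-1}}{(-q^a;q^m)_N\,(q^b;q^m)_M},$$ and for $k,N,M\in\mathbb{N}$, $$G_{k,N,M}(x):=\frac{(-x^{k+1};x^{k+1})_{N+M-1}}{(-x^{k};x^{k+1})_N\,(x;x^{k+1})_M},$$ both expanded as formal power series. When $a=kb$ one has $G_{k,N,M}(q^b)=g_{a,b,a+b}(N,M;q)$. *)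

theory Defs
  imports Complex_Main "HOL-Computational_Algebra.Formal_Power_Series"
begin

definition q_pochhammer :: "'a::comm_ring_1 \<Rightarrow> 'a \<Rightarrow> nat \<Rightarrow> 'a" where
  "q_pochhammer z q n = (\<Prod>i<n. 1 - z * q ^ i)"

text \<open>The indeterminate \<open>q\<close> (respectively \<open>x\<close>) is \<^const>\<open>fps_X\<close>. For positive parameters
  the denominators have constant coefficient 1, so the quotients below are the usual
  power series expansions.\<close>

definition g_series :: "nat \<Rightarrow> nat \<Rightarrow> nat \<Rightarrow> nat \<Rightarrow> nat \<Rightarrow> real fps" where
  "g_series a b m N M =
     q_pochhammer (- (fps_X ^ m)) (fps_X ^ m) (N + M - 1) /
     (q_pochhammer (- (fps_X ^ a)) (fps_X ^ m) N * q_pochhammer (fps_X ^ b) (fps_X ^ m) M)"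

definition G_series :: "nat \<Rightarrow> nat \<Rightarrow> nat \<Rightarrow> real fps" where
  "G_series k N M =
     q_pochhammer (- (fps_X ^ (k + 1))) (fps_X ^ (k + 1)) (N + M - 1) /
     (q_pochhammer (- (fps_X ^ k)) (fps_X ^ (k + 1)) N * q_pochhammer fps_X (fps_X ^ (k + 1)) M)"

end

theory Submission
  imports Defs
begin

text \<open>Up to degree \<open>3k+1\<close> the only factors of the series that can produce negative coefficients are
  \<open>1/(1+x\<^sup>k)\<close> and, if \<open>N \<ge> 2\<close>, also \<open>1/(1+x\<^bsup>2k+1\<^esup>)\<close>. They are absorbed by a few other
  factors; with \<open>y = x\<^sup>k\<close> this rests on the identities
  \<open>(1+xy) / ((1-x)(1+y)) = 1/(1-x) - y/(1+y)\<close> and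
  \<open>(1+xy)(1+x\<^sup>2y\<^sup>2) / ((1-x)(1+y)(1+xy\<^sup>2)) = 1/(1-x) - y/(1+y) - xy\<^sup>2/(1+y) + O(x\<^sup>2y\<^sup>3)\<close>.
  The second expression has a negative coefficient (at \<open>x\<^sup>3\<close>) only for \<open>k = 1\<close>, where the factor
  \<open>1/(1-x\<^sup>3)\<close>, available because \<open>M \<ge> N \<ge> 2\<close>, repairs it.\<close>

section \<open>Truncated nonnegativity and its closure properties\<close>

definition nonneg_below :: "nat \<Rightarrow> 'a::linordered_idom fps \<Rightarrow> bool" where
  "nonneg_below n f \<longleftrightarrow> (\<forall>r<n. fps_nth f r \<ge> 0)"

lemma nonneg_below_1: "nonneg_below n 1"
  by (simp add: nonneg_below_def)

lemma nonneg_below_mult: "nonneg_below n f \<Longrightarrow> nonneg_below n g \<Longrightarrow> nonneg_below n (f * g)"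
  unfolding nonneg_below_def fps_mult_nth by (intro allI impI sum_nonneg mult_nonneg_nonneg) auto

lemma nonneg_below_prod:
  "(\<And>i. i \<in> A \<Longrightarrow> nonneg_below n (f i)) \<Longrightarrow> nonneg_below n (\<Prod>i\<in>A. f i)"
  by (induction A rule: infinite_finite_induct) (auto intro: nonneg_below_1 nonneg_below_mult)

text \<open>Only the term with \<open>b * i = r\<close> contributes to coefficient \<open>r\<close>,
  and \<open>r < b * n\<close> forces \<open>i < n\<close>.\<close>

lemma nonneg_below_compose_X_power:
  assumes "nonneg_below n f" "b > 0"
  shows "nonneg_below (b * n) (f oo fps_X ^ b)"
proof -
  have "fps_nth f i * fps_nth ((fps_X ^ b) ^ i) r \<ge> 0" if "r < b * n" for i r
    using assms that by (auto simp: nonneg_below_def fps_X_power_nth simp flip: power_mult)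
  then show ?thesis
    by (auto simp: nonneg_below_def fps_compose_nth intro!: sum_nonneg)
qed

section \<open>Geometric series and the signs of their coefficients\<close>

lemma inverse_one_minus_const_X_power:
  fixes c :: "'a::field"
  assumes "j > 0"
  shows "inverse (1 - fps_const c * fps_X ^ j) =
    Abs_fps (\<lambda>n. if j dvd n then c ^ (n div j) else 0)" (is "inverse ?f = ?g")
proof (rule fps_inverse_unique)
  have "fps_nth ?g n - c * fps_nth (fps_X ^ j * ?g) n = fps_nth 1 n" for n
  proof (cases "n < j")
    case True
    then show ?thesis
      using assms by (auto simp: fps_X_power_mult_nth dest: dvd_imp_le)
  next
    case False
    then have "n div j = Suc ((n - j) div j)"
      using assms by (simp add: le_div_geq)
    then show ?thesis
      using False assms by (auto simp: fps_X_power_mult_nth dvd_minus_self)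
  qed
  then show "?f * ?g = 1"
    by (simp add: fps_eq_iff left_diff_distrib mult.assoc)
qed

lemma inverse_one_plus_X_power:
  assumes "j > 0"
  shows "inverse (1 + fps_X ^ j :: 'a::field fps) =
    Abs_fps (\<lambda>n. if j dvd n then (-1) ^ (n div j) else 0)"
  using inverse_one_minus_const_X_power[OF assms, of "-1"] by (simp flip: fps_const_neg)

lemma nonneg_below_one_plus_X_power: "nonneg_below n (1 + fps_X ^ j)"
  by (simp add: nonneg_below_def fps_X_power_nth)

lemma nonneg_below_inverse_one_minus_X_power:
  "j > 0 \<Longrightarrow> nonneg_below n (inverse (1 - fps_X ^ j :: 'a::linordered_field fps))"
  using inverse_one_minus_const_X_power[of j "1::'a"] by (simp add: nonneg_below_def)

text \<open>The first negative coefficient sits in degree \<open>j\<close>, just outside the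
  range.\<close>

lemma nonneg_below_inverse_one_plus_X_power:
  "n \<le> j \<Longrightarrow> j > 0 \<Longrightarrow> nonneg_below n (inverse (1 + fps_X ^ j :: 'a::linordered_field fps))"
  by (auto simp: nonneg_below_def inverse_one_plus_X_power dest: dvd_imp_le)

section \<open>Absorbing the factors with negative coefficients\<close>

text \<open>Multiply 1 + xy = (1 + y) - y(1 - x) by \<open>I * J\<close>, where \<open>I\<close> and
  \<open>J\<close> stand for the inverses of 1 - x and 1 + y.\<close>

lemma core_one_identity:
  fixes x y :: "'a::comm_ring_1"
  assumes "I * (1 - x) = 1" "J * (1 + y) = 1"
  shows "(1 + x * y) * I * J = I - y * J"
proof -
  have "(1 + x * y) * I * J = I * (J * (1 + y)) - y * J * (I * (1 - x))"
    by (simp add: algebra_simps)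
  then show ?thesis
    by (simp add: assms)
qed

text \<open>First write 1 + x^2 y^2 = (1 + x y^2) - x y^2 (1 - x), then, in the product of the
  second term with 1 + xy, 1 + xy = (1 + x y^2) + xy(1 - y). For y = x^k the last summand starts
  only in degree 3k + 2.\<close>

lemma core_two_identity:
  fixes x y :: "'a::comm_ring_1"
  assumes "I * (1 - x) = 1" "J * (1 + y) = 1" "L * (1 + x * y^2) = 1"
  shows "(1 + x * y) * (1 + x^2 * y^2) * I * J * L =
    I - y * J - x * y^2 * J - x^2 * y^3 * (J * L * (1 - y))"
proof -
  have "(1 + x * y) * (1 + x^2 * y^2) * I * J * L =
      (1 + x * y) * I * J * (L * (1 + x * y^2)) - x * y^2 * J * (L * (1 + x * y^2)) * (I * (1 - x)) -
      x^2 * y^3 * (J * L * (1 - y)) * (I * (1 - x))"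
    by (simp add: algebra_simps power2_eq_square power3_eq_cube)
  then show ?thesis
    by (simp add: assms core_one_identity)
qed

text \<open>All coefficients of 1/(1 - x) are 1, and those of y/(1 + y) are at most 1.\<close>

lemma nonneg_below_core_one:
  assumes "k > 0"
  shows "nonneg_below n ((1 + fps_X ^ (k+1)) * inverse (1 - fps_X) *
    inverse (1 + fps_X ^ k :: real fps))"
proof -
  let ?I = "inverse (1 - fps_X :: real fps)" and ?J = "inverse (1 + fps_X ^ k :: real fps)"
  have "(1 + fps_X ^ (k+1)) * ?I * ?J = ?I - fps_X ^ k * ?J"
    using core_one_identity[of ?I fps_X ?J "fps_X ^ k"] assms
    by (simp add: inverse_mult_eq_1)
  moreover have "fps_nth ?J r \<le> 1" for r
    using assms by (simp add: inverse_one_plus_X_power minus_one_power_iff)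
  ultimately show ?thesis
    by (simp add: nonneg_below_def fps_X_power_mult_nth fps_inverse_one_minus_fps_X)
qed

lemma nonneg_below_core_two:
  assumes "k \<ge> 2"
  shows "nonneg_below (3*k+2) ((1 + fps_X ^ (k+1)) * (1 + fps_X ^ (2*k+2)) *
    inverse (1 - fps_X) * inverse (1 + fps_X ^ k) * inverse (1 + fps_X ^ (2*k+1) :: real fps))"
    (is "nonneg_below _ ?F")
  unfolding nonneg_below_def
proof (intro allI impI)
  let ?I = "inverse (1 - fps_X :: real fps)" and ?J = "inverse (1 + fps_X ^ k :: real fps)"
    and ?L = "inverse (1 + fps_X ^ (2*k+1) :: real fps)"
  fix r assume r: "r < 3*k+2"
  have pows: "fps_X * fps_X ^ k = (fps_X ^ (k+1) :: real fps)"
    "fps_X * (fps_X ^ k)^2 = (fps_X ^ (2*k+1) :: real fps)"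
    "fps_X^2 * (fps_X ^ k)^2 = (fps_X ^ (2*k+2) :: real fps)"
    "fps_X^2 * (fps_X ^ k)^3 = (fps_X ^ (3*k+2) :: real fps)"
    by (simp_all add: mult.commute flip: power_add power_mult power_Suc)
  have "?F = ?I - fps_X ^ k * ?J - fps_X ^ (2*k+1) * ?J
      - fps_X ^ (3*k+2) * (?J * ?L * (1 - fps_X ^ k))"
    using core_two_identity[of ?I fps_X ?J "fps_X ^ k" ?L] assms
    unfolding pows by (simp add: inverse_mult_eq_1)
  \<comment> \<open>The remainder is a multiple of x^(3k+2), hence invisible in degree
    \<open>r\<close>.\<close>
  then have eq: "fps_nth ?F r = 1 - (if r < k then 0 else fps_nth ?J (r - k))
      - (if r < 2*k+1 then 0 else fps_nth ?J (r - (2*k+1)))"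
    using r by (simp add: fps_X_power_mult_nth fps_inverse_one_minus_fps_X del: power_Suc)
  have J: "fps_nth ?J s = (if k dvd s then (-1) ^ (s div k) else 0)" for s
    using assms by (simp add: inverse_one_plus_X_power)
  have le: "fps_nth ?J s \<le> 1" for s
    by (simp add: J minus_one_power_iff)
  show "fps_nth ?F r \<ge> 0"
  proof (cases "r < 2*k+1")
    case True
    then show ?thesis unfolding eq using le[of "r-k"] by auto
  next
    case False
    \<comment> \<open>Now both subtracted coefficients may be present. Each is at most 1, so it
      suffices that they are never both positive.\<close>
    define s where "s = r - (2*k+1)"
    have s: "s \<le> k" "r - k = k + 1 + s" using r False by (auto simp: s_def)
    \<comment> \<open>For \<open>s = 0\<close> the second one is 1, and the first one, in degree k +
      1, vanishes because \<open>k \<ge> 2\<close>.\<close>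
    have z: "fps_nth ?J (r-k) \<le> 0" if "s = 0"
    proof -
      have "\<not> k dvd k + 1"
        using assms by (simp only: dvd_add_triv_left_iff) simp
      then show ?thesis
        using that s by (simp add: J)
    qed
    \<comment> \<open>For 0 < s \<le> k the second one is 0, or -1 when s = k.\<close>
    have "fps_nth ?J s \<le> 0" if "s \<noteq> 0"
      using that assms s by (auto simp: J dest: dvd_imp_le)
    then show ?thesis
      unfolding eq s_def[symmetric] using False le[of "r-k"] le[of s] z by (cases "s = 0") auto
  qed
qed

text \<open>The denominators pair up as (1 - x)(1 + x) = 1 - x^2 and (1 - x^3)(1 + x^3) = 1 - x^6,
  which leaves no negative sign in any degree.\<close>

lemma nonneg_below_core_two_one:
  "nonneg_below n ((1 + fps_X ^ 2) * (1 + fps_X ^ 4) * inverse (1 - fps_X) * inverse (1 - fps_X ^ 3) *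
    inverse (1 + fps_X) * inverse (1 + fps_X ^ 3 :: real fps))"
proof -
  have "inverse (1 - fps_X) * inverse (1 - fps_X ^ 3) * inverse (1 + fps_X) *
      inverse (1 + fps_X ^ 3 :: real fps) = inverse (1 - fps_X ^ 2) * inverse (1 - fps_X ^ 6)"
    unfolding fps_inverse_mult[symmetric]
    by (rule arg_cong[of _ _ inverse]) (simp add: algebra_simps power2_eq_square flip: power_add power_Suc power_Suc2)
  then have "(1 + fps_X ^ 2) * (1 + fps_X ^ 4) * inverse (1 - fps_X) * inverse (1 - fps_X ^ 3) *
      inverse (1 + fps_X) * inverse (1 + fps_X ^ 3 :: real fps) =
      (1 + fps_X ^ 2) * (1 + fps_X ^ 4) * (inverse (1 - fps_X ^ 2) * inverse (1 - fps_X ^ 6))"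
    by (simp only: mult.assoc)
  then show ?thesis
    by (simp only:) (simp add: nonneg_below_mult nonneg_below_one_plus_X_power
        nonneg_below_inverse_one_minus_X_power)
qed

section \<open>Product form of the series and the main estimate\<close>

lemma fps_nth_0_prod:
  fixes f :: "'b \<Rightarrow> 'a::comm_ring_1 fps"
  shows "fps_nth (\<Prod>i\<in>A. f i) 0 = (\<Prod>i\<in>A. fps_nth (f i) 0)"
  by (induction A rule: infinite_finite_induct) auto

lemma G_series_eq_prod:
  assumes "k > 0"
  shows "G_series k N M = (\<Prod>i<N+M-1. 1 + fps_X ^ ((k+1) * (i+1))) *
    (\<Prod>i<N. inverse (1 + fps_X ^ (k + (k+1) * i))) *
    (\<Prod>i<M. inverse (1 - fps_X ^ (1 + (k+1) * i)))"
proof -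
  let ?D = "(\<Prod>i<N. 1 + fps_X ^ (k + (k+1) * i)) * (\<Prod>i<M. 1 - fps_X ^ (1 + (k+1) * i)) :: real fps"
  have pow: "fps_X ^ j * (fps_X ^ m) ^ i = (fps_X ^ (j + m * i) :: real fps)" for j m i
    by (simp add: power_add power_mult)
  have "G_series k N M = (\<Prod>i<N+M-1. 1 + fps_X ^ ((k+1) * (i+1))) / ?D"
    using pow[of "k+1" "k+1"] pow[of k] pow[of 1]
    by (simp add: G_series_def q_pochhammer_def del: power_Suc power_Suc2)
  also have "\<dots> = (\<Prod>i<N+M-1. 1 + fps_X ^ ((k+1) * (i+1))) * inverse ?D"
    using assms by (intro fps_divide_unit) (simp add: fps_nth_0_prod)
  finally show ?thesis
    by (simp add: fps_inverse_mult inverse_prod_fps mult.assoc)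
qed

lemma prod_lessThan_split:
  fixes f :: "nat \<Rightarrow> 'a::comm_monoid_mult"
  shows "m \<le> n \<Longrightarrow> (\<Prod>i<n. f i) = (\<Prod>i<m. f i) * (\<Prod>i=m..<n. f i)"
  by (simp add: lessThan_atLeast0 prod.atLeastLessThan_concat)

lemma nonneg_below_G_series:
  assumes "k > 0" "N > 0" "M > 0" "N \<le> M"
  shows "nonneg_below (3*k+2) (G_series k N M)"
proof -
  let ?n = "3*k+2"
  define f where "f i = (1 + fps_X ^ ((k+1) * (i+1)) :: real fps)" for i
  define g where "g i = inverse (1 + fps_X ^ (k + (k+1) * i) :: real fps)" for i
  define h where "h i = inverse (1 - fps_X ^ (1 + (k+1) * i) :: real fps)" for i
  have f: "nonneg_below ?n (\<Prod>i\<in>A. f i)" for A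
    by (intro nonneg_below_prod) (simp only: f_def nonneg_below_one_plus_X_power)
  have h: "nonneg_below ?n (\<Prod>i\<in>A. h i)" for A
    by (intro nonneg_below_prod) (simp only: h_def nonneg_below_inverse_one_minus_X_power)
  have g: "nonneg_below ?n (\<Prod>i=2..<N. g i)"
  proof (intro nonneg_below_prod)
    \<comment> \<open>For i \<ge> 2 the exponent k + (k+1)i is at least 3k + 2, so the factor agrees
      with 1 below the bound.\<close>
    fix i assume "i \<in> {2..<N}"
    then have "(k+1) * 2 \<le> (k+1) * i"
      by (intro mult_le_mono2) simp
    then show "nonneg_below ?n (g i)"
      unfolding g_def by (intro nonneg_below_inverse_one_plus_X_power) auto
  qed
  have G: "G_series k N M = (\<Prod>i<N+M-1. f i) * (\<Prod>i<N. g i) * (\<Prod>i<M. h i)"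
    using G_series_eq_prod[OF assms(1)] by (simp add: f_def g_def h_def)
  \<comment> \<open>It suffices to treat an initial block of each product: the remaining
    \<open>f\<close> and \<open>h\<close> factors are harmless, and so are the remaining
    \<open>g\<close> factors once \<open>q\<close> is large enough.\<close>
  have core: "nonneg_below ?n (G_series k N M)"
    if "p \<le> N + M - 1" "q \<le> N" "l \<le> M" "nonneg_below ?n (\<Prod>i=q..<N. g i)"
      "nonneg_below ?n ((\<Prod>i<p. f i) * (\<Prod>i<l. h i) * (\<Prod>i<q. g i))" for p q l
  proof -
    have "G_series k N M = ((\<Prod>i<p. f i) * (\<Prod>i<l. h i) * (\<Prod>i<q. g i)) *
        ((\<Prod>i=p..<N+M-1. f i) * (\<Prod>i=q..<N. g i) * (\<Prod>i=l..<M. h i))"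
      unfolding G prod_lessThan_split[OF that(1)] prod_lessThan_split[OF that(2)]
        prod_lessThan_split[OF that(3)]
      by (simp only: mult_ac)
    then show ?thesis
      using that(4,5) f h by (simp add: nonneg_below_mult)
  qed
  consider "N = 1" | "N \<ge> 2" "k \<ge> 2" | "N \<ge> 2" "k = 1"
    using assms by linarith
  then show ?thesis
  proof cases
    case 1
    then show ?thesis
      using assms nonneg_below_core_one[OF assms(1)]
      by (intro core[of 1 1 1]) (simp_all add: f_def g_def h_def nonneg_below_1)
  next
    case 2
    have "nonneg_below ?n ((\<Prod>i<2. f i) * (\<Prod>i<1. h i) * (\<Prod>i<2. g i))"
      using nonneg_below_core_two[OF 2(2)]
      by (simp add: f_def g_def h_def numeral_2_eq_2 mult.assoc)
    then show ?thesis
      using core[of 2 2 1] assms 2 g by simp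
  next
    case 3
    \<comment> \<open>The second \<open>h\<close> factor, 1/(1 - x^3), exists because 2 \<le> N
      \<le> M.\<close>
    have "nonneg_below ?n ((\<Prod>i<2. f i) * (\<Prod>i<2. h i) * (\<Prod>i<2. g i))"
      using nonneg_below_core_two_one[of ?n] 3(2)
      by (simp add: f_def g_def h_def numeral_eq_Suc mult.assoc)
    then show ?thesis
      using core[of 2 2 2] assms 3 g by simp
  qed
qed

section \<open>Substituting a power of the variable\<close>

lemma q_pochhammer_compose:
  fixes z q c :: "'a::idom fps"
  assumes "fps_nth c 0 = 0"
  shows "q_pochhammer z q n oo c = q_pochhammer (z oo c) (q oo c) n"
  using assms by (simp add: q_pochhammer_def fps_compose_prod_distrib fps_compose_sub_distrib
      fps_compose_mult_distrib fps_compose_power)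

lemma g_series_eq_compose:
  assumes "k > 0" "b > 0"
  shows "g_series (k * b) b (k * b + b) N M = G_series k N M oo fps_X ^ b"
proof -
  have X: "fps_nth (fps_X ^ b :: real fps) 0 = 0"
    using assms by simp
  have pow: "fps_X ^ j oo fps_X ^ b = (fps_X ^ (j * b) :: real fps)" for j
    using X by (simp add: mult.commute power_mult flip: fps_compose_power)
  \<comment> \<open>Composition commutes with the quotient since the denominator is
    invertible.\<close>
  have D: "fps_nth (q_pochhammer (- (fps_X ^ k)) (fps_X ^ (k + 1)) N *
      q_pochhammer fps_X (fps_X ^ (k + 1)) M :: real fps) 0 \<noteq> 0"
    using assms by (simp add: q_pochhammer_def fps_nth_0_prod)
  have "k * b + b = (k + 1) * b" by simp
  then show ?thesis
    unfolding g_series_def G_series_def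
    by (simp only: fps_divide_compose[OF X D] fps_compose_mult_distrib[OF X] q_pochhammer_compose[OF X]
        fps_compose_uminus pow fps_X_fps_compose_startby0[OF X])
qed

theorem theorem1p4:
  "(\<forall>a b N M :: nat. a > 0 \<longrightarrow> b > 0 \<longrightarrow> N > 0 \<longrightarrow> M > 0 \<longrightarrow> b dvd a \<longrightarrow> N \<le> M \<longrightarrow>
      (\<forall>n < a + 2 * (a + b). fps_nth (g_series a b (a + b) N M) n \<ge> 0)) \<and>
   (\<forall>k N M :: nat. k > 0 \<longrightarrow> N > 0 \<longrightarrow> M > 0 \<longrightarrow> N \<le> M \<longrightarrow>
      (\<forall>r < 3 * k + 2. fps_nth (G_series k N M) r \<ge> 0))"
proof (intro conjI allI impI)
  fix a b N M n :: nat
  assume *: "a > 0" "b > 0" "N > 0" "M > 0" "b dvd a" "N \<le> M" "n < a + 2 * (a + b)"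
  then obtain k where k: "a = k * b"
    by (metis dvdE mult.commute)
  \<comment> \<open>With a = kb the bound a + 2(a + b) equals b(3k + 2), the image of 3k + 2 under
    substituting x^b for x.\<close>
  then have "k > 0" "n < b * (3*k+2)"
    using * by (auto simp: algebra_simps)
  then show "fps_nth (g_series a b (a + b) N M) n \<ge> 0"
    using nonneg_below_compose_X_power[OF nonneg_below_G_series, of k N M b] *
    unfolding k by (simp add: g_series_eq_compose nonneg_below_def)
next
  fix k N M r :: nat
  assume "k > 0" "N > 0" "M > 0" "N \<le> M" "r < 3 * k + 2"
  then show "fps_nth (G_series k N M) r \<ge> 0"
    using nonneg_below_G_series unfolding nonneg_below_def by blast
qed

end
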